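(* For every integer $n\ge 1$, $$|\mathfrak{D}^4_{2n}(321;1)| = |S_n(321;1)|+|S_{n+1}(321;1)| = \frac{3}{n}\binom{2n}{n-3}+\frac{3}{n+1}\binom{2n+2}{n-2} = C_{n+3}-3C_{n+2}-C_{n+1}+3C_n.$$
   Context: $S_n$ is the set of permutations of $[n]=\{1,\dots,n\}$. A Dumont permutation of the fourth kind (Dumont-4 permutation) of size $2n$ is a permutation $\pi$ of $[2n]$ in which all deficiencies are even values at even positions: for all $1\le i\le 2n$, if $\pi(i)<i$ then both $i$ and $\pi(i)$ are even. The set of these is $\mathfrak{D}^4_{2n}$. An occurrence of $321$ in a permutation $\pi$ is a triple of indices $i<j<k$ with $\pi(i)>\pi(j)>\pi(k)$. $S_n(321;1)$ and $\mathfrak{D}^4_{2n}(321;1)$ denote the sets of permutations in $S_n$ and in $\mathfrak{D}^4_{2n}$, respectively, having exactly one occurrence of $321$. $C_n=\frac{1}{n+1}\binom{2n}{n}$ is the $n$-th Catalan number. Binomial coefficients $\binom{a}{b}$ with $b<0$ are $0$. *)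

theory Defs
  imports Complex_Main "HOL-Combinatorics.Permutations"
begin

(* A permutation of [n] is a function nat => nat that permutes {1..n}; it is the identity
   outside {1..n}, so distinct functions are distinct permutations of [n]. *)

definition occurrences_321 :: "nat \<Rightarrow> (nat \<Rightarrow> nat) \<Rightarrow> (nat \<times> nat \<times> nat) set" where
  "occurrences_321 n \<pi> =
     {(i, j, k). 1 \<le> i \<and> i < j \<and> j < k \<and> k \<le> n \<and> \<pi> i > \<pi> j \<and> \<pi> j > \<pi> k}"

definition perms_321_once :: "nat \<Rightarrow> (nat \<Rightarrow> nat) set" where
  "perms_321_once n = {\<pi>. \<pi> permutes {1..n} \<and> card (occurrences_321 n \<pi>) = 1}"

(* The argument is the size of the permutations, so Dumont permutations of the fourth kind
   of size 2n are the elements of dumont4 (2 * n). *)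
definition dumont4 :: "nat \<Rightarrow> (nat \<Rightarrow> nat) set" where
  "dumont4 m =
     {\<pi>. \<pi> permutes {1..m} \<and> (\<forall>i\<in>{1..m}. \<pi> i < i \<longrightarrow> even i \<and> even (\<pi> i))}"

definition dumont4_321_once :: "nat \<Rightarrow> (nat \<Rightarrow> nat) set" where
  "dumont4_321_once m = {\<pi> \<in> dumont4 m. card (occurrences_321 m \<pi>) = 1}"

(* The lower index is an integer: truncated subtraction on nat would turn the binomial
   coefficients with lower index n - 3 or n - 2 into 1 instead of 0 for small n. *)
definition binom :: "nat \<Rightarrow> int \<Rightarrow> nat" where
  "binom a b = (if b < 0 then 0 else a choose nat b)"

definition catalan :: "nat \<Rightarrow> real" where
  "catalan n = real ((2 * n) choose n) / real (n + 1)"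

end

theory Submission
  imports Defs "HOL-Library.Infinite_Set"
begin

text \<open>A permutation with exactly one occurrence \<open>c b a\<close> of 321 is a lattice path with one marked step,
and the theorem compares and counts such paths.

Let \<open>\<pi>\<close> have exactly one occurrence of 321, with middle entry \<open>b\<close>. Uniqueness forces every entry to the
left of \<open>b\<close> except \<open>c\<close> to be smaller than \<open>b\<close>, and every entry to its right except \<open>a\<close> to be larger, so
\<open>b\<close> is a fixed point. Moreover an inversion among the deficiencies (\<open>\<pi> p < p\<close>), or among the remaining
entries other than \<open>b\<close>, would extend to a second occurrence. So \<open>\<pi>\<close> consists of two increasing
sequences and the fixed point \<open>b\<close>, and it is determined by \<open>b\<close>, the set \<open>A\<close> of positions of its
deficiencies and the set \<open>V\<close> of their values.

Read \<open>x = 1, 2, \<dots>, n\<close> and record whether \<open>x\<close> lies in \<open>A\<close> and whether it lies in \<open>V\<close>. Let the height be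
the number of elements of \<open>V\<close> minus the number of elements of \<open>A\<close> read so far; it counts the values
still waiting for their position. The pairs that come from permutations give paths that start and end
at height 0, may read an element of \<open>A\<close> only at positive height, and are otherwise free; these are the
Motzkin paths with two kinds of level step, one of them forbidden at height 0. That \<open>b\<close> is the middle
of exactly one occurrence means that \<open>b\<close> is a level step with \<open>b \<notin> A \<union> V\<close> at height 1. Conversely every
path with such a marked step arises (\<open>code_surj\<close>).

A Dumont permutation of the fourth kind of size \<open>2 * n\<close> is one with \<open>A\<close> and \<open>V\<close> consisting of even
numbers. If the mark \<open>b\<close> is even, halving gives a path of length \<open>n\<close> with a marked level step. If \<open>b\<close> is
odd, halving gives a path of length \<open>n\<close> with a marked vertex at height 1, and inserting a level step at
that vertex gives a path of length \<open>n + 1\<close> with a marked level step. This is the first equation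
(\<open>card_codes_even\<close>).

For the explicit formula, count paths from height 0 to an arbitrary height \<open>d\<close>, by their last step. The
resulting recurrences, for paths with and without a mark, are solved by differences of binomial
coefficients (\<open>unmarked_count_eq\<close>, \<open>marked_count_eq\<close>), and each verification is a repeated use of
Pascal's rule. The unmarked paths that end at height 0 are counted by the Catalan numbers, which turns
the last equation into another consequence of their recurrence.\<close>

section \<open>Order isomorphisms between finite sets of numbers\<close>

lemma strict_mono_on_rank:
  fixes f :: "nat \<Rightarrow> nat"
  assumes "strict_mono_on A f" "x \<in> A"
  shows "card (f ` A \<inter> {..f x}) = card (A \<inter> {..x})"
proof -
  have "f ` A \<inter> {..f x} = f ` (A \<inter> {..x})"
    using assms by (auto simp: strict_mono_on_less_eq)
  moreover have "inj_on f (A \<inter> {..x})"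
    using assms(1) by (meson Int_lower1 inj_on_subset strict_mono_on_imp_inj_on)
  ultimately show ?thesis
    by (simp add: card_image)
qed

text \<open>The value of an increasing map at \<open>x\<close> is the element of the image that has the rank of \<open>x\<close>.\<close>
lemma strict_mono_on_unique:
  fixes f g :: "nat \<Rightarrow> nat"
  assumes "strict_mono_on A f" "strict_mono_on A g" "f ` A = g ` A" "x \<in> A"
  shows "f x = g x"
proof -
  have less: False
    if "strict_mono_on A f" "strict_mono_on A g" "f ` A = g ` A" "f x < g x" for f g :: "nat \<Rightarrow> nat"
  proof -
    have "g x \<in> f ` A"
      using \<open>x \<in> A\<close> that(3) by blast
    then have "f ` A \<inter> {..f x} \<subset> f ` A \<inter> {..g x}"
      using that(4) by (intro psubsetI) (auto simp: set_eq_iff not_le intro!: exI[of _ "g x"])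
    then have "card (f ` A \<inter> {..f x}) < card (g ` A \<inter> {..g x})"
      unfolding that(3) by (intro psubset_card_mono) auto
    then show False
      using strict_mono_on_rank[OF that(1) \<open>x \<in> A\<close>] strict_mono_on_rank[OF that(2) \<open>x \<in> A\<close>] by simp
  qed
  show ?thesis
    using less[of f g] less[of g f] assms by (cases "f x" "g x" rule: linorder_cases) auto
qed

lemma ex_order_iso:
  fixes A V :: "nat set"
  assumes "finite A" "finite V" "card A = card V"
  obtains f where "bij_betw f A V" "strict_mono_on A f"
proof -
  obtain h where h: "bij_betw h {..<card A} A" "strict_mono_on {..<card A} h"
    using ex_bij_betw_strict_mono_card[OF assms(1)] .
  obtain k where k: "bij_betw k {..<card A} V" "strict_mono_on {..<card A} k"
    using ex_bij_betw_strict_mono_card[OF assms(2)] assms(3) by metis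
  let ?g = "the_inv_into {..<card A} h"
  have g: "bij_betw ?g A {..<card A}"
    using h(1) by (rule bij_betw_the_inv_into)
  have hg: "h (?g x) = x" if "x \<in> A" for x
    using h(1) that by (rule f_the_inv_into_f_bij_betw)
  have "strict_mono_on A (k \<circ> ?g)"
  proof (rule strict_mono_onI)
    fix x y assume xy: "x \<in> A" "y \<in> A" "x < y"
    have "?g x \<in> {..<card A}" "?g y \<in> {..<card A}"
      using g xy by (auto simp: bij_betw_def)
    moreover from this have "?g x < ?g y"
      using strict_mono_on_less[OF h(2), of "?g x" "?g y"] xy by (simp add: hg)
    ultimately show "(k \<circ> ?g) x < (k \<circ> ?g) y"
      using strict_mono_onD[OF k(2)] by simp
  qed
  with bij_betw_trans[OF g k(1)] show ?thesis
    by (rule that)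
qed

section \<open>Ballot pairs and codes\<close>

text \<open>In terms of paths: a step \<open>x \<in> A\<close> starts at positive height. For finite \<open>A\<close> and \<open>V\<close> of the same size, this
holds exactly if the increasing bijection from \<open>A\<close> to \<open>V\<close> satisfies \<open>f x < x\<close>, that is, exactly if it can
serve as the sequence of deficiencies of a permutation. Only the \<open>x \<in> A\<close> are constrained, so that the
condition is invariant under increasing relabellings.\<close>
definition ballot :: "nat set \<Rightarrow> nat set \<Rightarrow> bool" where
  "ballot A V \<longleftrightarrow> (\<forall>x\<in>A. card (A \<inter> {..x}) \<le> card (V \<inter> {..<x}))"

text \<open>The step \<open>b\<close> is level at height 1, and it belongs to neither of the two sets.\<close>
definition marked :: "nat set \<Rightarrow> nat set \<Rightarrow> nat \<Rightarrow> bool" where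
  "marked A V b \<longleftrightarrow> b \<notin> A \<and> b \<notin> V \<and> card (V \<inter> {..<b}) = Suc (card (A \<inter> {..<b}))"

text \<open>The mark ranges over a set of its own, because in a Dumont permutation it may be odd although
all elements of \<open>A\<close> and \<open>V\<close> are even.\<close>
definition codes :: "nat set \<Rightarrow> nat set \<Rightarrow> (nat set \<times> nat set \<times> nat) set" where
  "codes S B = {(A, V, b). A \<subseteq> S \<and> V \<subseteq> S \<and> b \<in> B \<and> ballot A V \<and> card V = card A \<and> marked A V b}"

definition deficiencies :: "(nat \<Rightarrow> nat) \<Rightarrow> nat set" where
  "deficiencies \<pi> = {p. \<pi> p < p}"

definition code :: "(nat \<Rightarrow> nat) \<times> nat \<Rightarrow> nat set \<times> nat set \<times> nat" where
  "code = (\<lambda>(\<pi>, b). (deficiencies \<pi>, \<pi> ` deficiencies \<pi>, b))"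

section \<open>The structure of permutations with one occurrence of 321\<close>

text \<open>The last condition says that exactly one value smaller than \<open>b\<close> is placed after \<open>b\<close>; then also exactly
one value larger than \<open>b\<close> is placed before \<open>b\<close> (\<open>crossings_balanced\<close>), and together with \<open>b\<close> these two
form the only occurrence of 321.\<close>
definition two_chains :: "nat \<Rightarrow> (nat \<Rightarrow> nat) \<Rightarrow> nat \<Rightarrow> bool" where
  "two_chains n \<pi> b \<longleftrightarrow> \<pi> permutes {1..n} \<and> b \<in> {1..n} \<and> \<pi> b = b
     \<and> strict_mono_on (deficiencies \<pi>) \<pi>
     \<and> strict_mono_on ({1..n} - deficiencies \<pi> - {b}) \<pi>
     \<and> card {k. b < k \<and> \<pi> k < b} = 1"

lemma permutes_interval_le: "\<pi> permutes {1..n} \<Longrightarrow> p \<le> n \<Longrightarrow> \<pi> p \<le> n"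
  for \<pi> :: "nat \<Rightarrow> nat"
  using permutes_in_image[of \<pi> "{1..n}" p] permutes_not_in[of \<pi> "{1..n}" p] by fastforce

lemma permutes_interval_ge: "\<pi> permutes {1..n} \<Longrightarrow> 1 \<le> p \<Longrightarrow> 1 \<le> \<pi> p"
  for \<pi> :: "nat \<Rightarrow> nat"
  using permutes_in_image[of \<pi> "{1..n}" p] permutes_not_in[of \<pi> "{1..n}" p] by fastforce

lemma permutes_neq: "\<pi> permutes S \<Longrightarrow> x \<noteq> y \<Longrightarrow> \<pi> x \<noteq> \<pi> y"
  by (meson injD permutes_inj)

lemma deficiencies_subset: "\<pi> permutes {1..n} \<Longrightarrow> deficiencies \<pi> \<subseteq> {1..n}"
  unfolding deficiencies_def using permutes_not_in[of \<pi> "{1..n}"] by fastforce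

lemma image_deficiencies_subset: "\<pi> permutes {1..n} \<Longrightarrow> \<pi> ` deficiencies \<pi> \<subseteq> {1..n}"
  using deficiencies_subset permutes_image by blast

lemma finite_deficiencies: "\<pi> permutes {1..n} \<Longrightarrow> finite (deficiencies \<pi>)"
  by (rule finite_subset[OF deficiencies_subset]) auto

text \<open>The \<open>p - 1\<close> earlier entries do not fit into the \<open>\<pi> p - 1 < p - 1\<close> values below \<open>\<pi> p\<close>. Hence an
inversion that starts with a deficiency extends to the left to an occurrence of 321.\<close>
lemma deficiency_has_larger_before:
  fixes \<pi> :: "nat \<Rightarrow> nat"
  assumes "\<pi> permutes {1..n}" "\<pi> p < p"
  obtains r where "1 \<le> r" "r < p" "\<pi> p < \<pi> r"
proof (rule ccontr)
  assume neg: "\<not> thesis"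
  have "\<pi> ` {1..<p} \<subseteq> {1..<\<pi> p}"
  proof
    fix v assume "v \<in> \<pi> ` {1..<p}"
    then obtain r where r: "v = \<pi> r" "1 \<le> r" "r < p" by auto
    then have "\<not> \<pi> p < \<pi> r" using neg that[of r] by auto
    moreover have "\<pi> r \<noteq> \<pi> p" using permutes_neq[OF assms(1), of r p] r by simp
    ultimately show "v \<in> {1..<\<pi> p}"
      using r permutes_interval_ge[OF assms(1), of r] by simp
  qed
  then have "card (\<pi> ` {1..<p}) \<le> card {1..<\<pi> p}"
    by (intro card_mono) auto
  moreover have "card (\<pi> ` {1..<p}) = card {1..<p}"
    using assms(1) by (intro card_image) (metis inj_on_subset permutes_inj subset_UNIV)
  moreover have "1 \<le> \<pi> p"
    using permutes_interval_ge[OF assms(1), of p] assms(2) by simp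
  ultimately show False
    using assms(2) by simp
qed

text \<open>Otherwise all \<open>\<pi> q - 1\<close> smaller values would occupy the \<open>q - 2\<close> earlier positions other than \<open>p\<close>. Hence
an inversion that ends with a weak excedance extends to the right to an occurrence of 321.\<close>
lemma weak_excedance_has_smaller_after:
  fixes \<pi> :: "nat \<Rightarrow> nat"
  assumes "\<pi> permutes {1..n}" "1 \<le> p" "p < q" "q \<le> n" "\<pi> q < \<pi> p" "q \<le> \<pi> q"
  obtains r where "q < r" "r \<le> n" "\<pi> r < \<pi> q"
proof (rule ccontr)
  assume neg: "\<not> thesis"
  have "{1..<\<pi> q} \<subseteq> \<pi> ` ({1..<q} - {p})"
  proof
    fix v assume v: "v \<in> {1..<\<pi> q}"
    moreover have "\<pi> q \<le> n"
      using permutes_interval_le[OF assms(1,4)] .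
    ultimately have "v \<in> \<pi> ` {1..n}"
      using permutes_image[OF assms(1)] by simp
    then obtain r where r: "v = \<pi> r" "r \<in> {1..n}" by blast
    have "\<not> q < r"
      using neg that[of r] v r by auto
    moreover have "r \<noteq> q" "r \<noteq> p"
      using v r assms(5) by auto
    ultimately show "v \<in> \<pi> ` ({1..<q} - {p})"
      using r by auto
  qed
  then have "card {1..<\<pi> q} \<le> card (\<pi> ` ({1..<q} - {p}))"
    by (intro card_mono) auto
  also have "\<dots> \<le> card ({1..<q} - {p})"
    by (intro card_image_le) auto
  finally show False
    using assms by simp
qed

text \<open>The middle entry of the occurrence is the fixed point. An inversion inside one of the two
sequences would be part of an occurrence with a different middle entry, by the two preceding lemmas.\<close>
lemma perms_321_once_imp_two_chains:
  assumes "\<pi> permutes {1..n}" "card (occurrences_321 n \<pi>) = 1"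
  shows "\<exists>b. two_chains n \<pi> b"
proof -
  obtain i b k where occ: "occurrences_321 n \<pi> = {(i, b, k)}"
    using assms(2) by (metis card_1_singletonE prod_cases3)
  then have "(i, b, k) \<in> occurrences_321 n \<pi>" by simp
  then have ibk: "1 \<le> i" "i < b" "b < k" "k \<le> n" "\<pi> b < \<pi> i" "\<pi> k < \<pi> b"
    by (auto simp: occurrences_321_def)
  have uniq: "x = i \<and> y = b \<and> z = k"
    if "1 \<le> x" "x < y" "y < z" "z \<le> n" "\<pi> y < \<pi> x" "\<pi> z < \<pi> y" for x y z
  proof -
    have "(x, y, z) \<in> occurrences_321 n \<pi>"
      using that by (simp add: occurrences_321_def)
    then show ?thesis by (simp add: occ)
  qed
  note neq = permutes_neq[OF assms(1)]
  \<comment> \<open>An entry that violates one of the next two facts would give a second occurrence with the same middle.\<close>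
  have left: "\<pi> p < \<pi> b" if "1 \<le> p" "p < b" "p \<noteq> i" for p
    using uniq[of p b k] neq[of p b] that ibk by linarith
  have right: "\<pi> b < \<pi> p" if "b < p" "p \<le> n" "p \<noteq> k" for p
    using uniq[of i b p] neq[of p b] that ibk by linarith
  \<comment> \<open>The values below the middle entry are those of the positions before it, with one position exchanged.\<close>
  have fixed: "\<pi> b = b"
  proof -
    have "\<pi> ` (({1..<b} - {i}) \<union> {k}) = {1..<\<pi> b}"
    proof (intro equalityI subsetI)
      fix v assume "v \<in> \<pi> ` (({1..<b} - {i}) \<union> {k})"
      then show "v \<in> {1..<\<pi> b}"
        using left ibk permutes_interval_ge[OF assms(1)] by auto
    next
      fix v assume v: "v \<in> {1..<\<pi> b}"
      moreover have "\<pi> b \<le> n"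
        using permutes_interval_le[OF assms(1), of b] ibk by simp
      ultimately have "v \<in> \<pi> ` {1..n}"
        using permutes_image[OF assms(1)] by simp
      then obtain p where p: "v = \<pi> p" "p \<in> {1..n}" by blast
      then have "p \<noteq> b" "p \<noteq> i" "\<not> (b < p \<and> p \<noteq> k)"
        using v ibk right[of p] by auto
      then show "v \<in> \<pi> ` (({1..<b} - {i}) \<union> {k})"
        using p by auto
    qed
    moreover have "card (\<pi> ` (({1..<b} - {i}) \<union> {k})) = card (({1..<b} - {i}) \<union> {k})"
      using assms(1) by (intro card_image) (metis inj_on_subset permutes_inj subset_UNIV)
    moreover have "card (({1..<b} - {i}) \<union> {k}) = b - 1"
      using ibk by simp
    ultimately show ?thesis
      using ibk by simp
  qed
  have "strict_mono_on (deficiencies \<pi>) \<pi>"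
  proof (rule strict_mono_onI)
    fix p q assume pq: "p \<in> deficiencies \<pi>" "q \<in> deficiencies \<pi>" "p < q"
    obtain r where r: "1 \<le> r" "r < p" "\<pi> p < \<pi> r"
      using deficiency_has_larger_before[OF assms(1)] pq(1) unfolding deficiencies_def by blast
    have "p \<noteq> b" "q \<le> n"
      using pq fixed deficiencies_subset[OF assms(1)] by (auto simp: deficiencies_def)
    then show "\<pi> p < \<pi> q"
      using uniq[of r p q] r pq neq[of p q] by linarith
  qed
  moreover have "strict_mono_on ({1..n} - deficiencies \<pi> - {b}) \<pi>"
  proof (rule strict_mono_onI, rule ccontr)
    fix p q assume pq: "p \<in> {1..n} - deficiencies \<pi> - {b}" "q \<in> {1..n} - deficiencies \<pi> - {b}" "p < q"
      "\<not> \<pi> p < \<pi> q"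
    then have "\<pi> q < \<pi> p" "1 \<le> p" "q \<le> n" "q \<le> \<pi> q" "q \<noteq> b"
      using neq[of p q] by (auto simp: deficiencies_def)
    then obtain r where "q < r" "r \<le> n" "\<pi> r < \<pi> q"
      using weak_excedance_has_smaller_after[OF assms(1)] pq(3) by metis
    then show False
      using uniq[of p q r] \<open>\<pi> q < \<pi> p\<close> \<open>1 \<le> p\<close> \<open>q \<noteq> b\<close> pq(3) by linarith
  qed
  moreover have "{k'. b < k' \<and> \<pi> k' < b} = {k}"
  proof -
    have "k' \<le> n" if "\<pi> k' < k'" for k'
      using deficiencies_subset[OF assms(1)] that unfolding deficiencies_def by auto
    then show ?thesis
      using right ibk fixed by fastforce
  qed
  ultimately show ?thesis
    using assms(1) fixed ibk unfolding two_chains_def by (intro exI[of _ b]) auto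
qed

text \<open>As many values cross the fixed point \<open>b\<close> upwards as downwards, because the positions below \<open>b\<close> and the
values below \<open>b\<close> are equally many.\<close>
lemma crossings_balanced:
  fixes \<pi> :: "nat \<Rightarrow> nat"
  assumes "\<pi> permutes {1..n}" "\<pi> b = b"
  shows "card {i. i < b \<and> b < \<pi> i} = card {k. b < k \<and> \<pi> k < b}"
proof -
  have neq: "\<pi> p \<noteq> b" if "p \<noteq> b" for p
    using permutes_neq[OF assms(1) that] assms(2) by simp
  have vals: "{..<b} = \<pi> ` {i. \<pi> i < b}"
    using permutes_surj[OF assms(1)] by (auto simp: image_iff surj_def)
  have inj: "inj_on \<pi> X" for X
    using assms(1) by (metis inj_on_subset permutes_inj subset_UNIV)
  have "finite (\<pi> ` {i. \<pi> i < b})"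
    by (subst vals[symmetric]) simp
  then have fin: "finite {i. \<pi> i < b}"
    using inj finite_image_iff by blast
  have 1: "{i. \<pi> i < b} = {i. i < b \<and> \<pi> i < b} \<union> {k. b < k \<and> \<pi> k < b}"
    using assms(2) by auto (metis less_irrefl linorder_cases)
  have 2: "{..<b} = {i. i < b \<and> \<pi> i < b} \<union> {i. i < b \<and> b < \<pi> i}"
    using neq by auto (metis less_irrefl linorder_cases)
  have "card {i. i < b \<and> \<pi> i < b} + card {i. i < b \<and> b < \<pi> i} = card {..<b}"
    by (subst 2, subst card_Un_disjoint) auto
  also have "\<dots> = card {i. \<pi> i < b}"
    by (subst vals) (rule card_image[OF inj])
  also have "\<dots> = card {i. i < b \<and> \<pi> i < b} + card {k. b < k \<and> \<pi> k < b}"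
    using fin by (subst 1, subst card_Un_disjoint) (auto intro: finite_subset[OF _ fin])
  finally show ?thesis by simp
qed

text \<open>The height of the path just before \<open>b\<close> is the number of values that cross \<open>b\<close> downwards.\<close>
lemma card_small_deficiency_values:
  assumes "\<pi> permutes {1..n}" "\<pi> b = b"
  shows "card (\<pi> ` deficiencies \<pi> \<inter> {..<b})
    = card (deficiencies \<pi> \<inter> {..<b}) + card {k. b < k \<and> \<pi> k < b}"
proof -
  let ?D = "deficiencies \<pi>"
  have inj: "inj_on \<pi> X" for X
    using assms(1) by (metis inj_on_subset permutes_inj subset_UNIV)
  have "finite {k. b < k \<and> \<pi> k < b}"
    by (rule finite_subset[OF _ finite_deficiencies[OF assms(1)]]) (auto simp: deficiencies_def)
  moreover have "\<pi> ` ?D \<inter> {..<b} = \<pi> ` ((?D \<inter> {..<b}) \<union> {k. b < k \<and> \<pi> k < b})"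
  proof -
    have "?D \<inter> {k. \<pi> k < b} = (?D \<inter> {..<b}) \<union> {k. b < k \<and> \<pi> k < b}"
    proof (intro set_eqI)
      fix k
      show "k \<in> ?D \<inter> {k. \<pi> k < b} \<longleftrightarrow> k \<in> (?D \<inter> {..<b}) \<union> {k. b < k \<and> \<pi> k < b}"
        using assms(2) by (cases k b rule: linorder_cases) (auto simp: deficiencies_def)
    qed
    moreover have "\<pi> ` ?D \<inter> {..<b} = \<pi> ` (?D \<inter> {k. \<pi> k < b})"
      by auto
    ultimately show ?thesis by simp
  qed
  ultimately show ?thesis
    using card_image[OF inj] by (simp, subst card_Un_disjoint) auto
qed

text \<open>In an occurrence, one entry comes from each of the two increasing sequences and the third one is the
fixed point \<open>b\<close>. Only the middle place is possible for \<open>b\<close>, and the crossing condition then leaves one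
choice for each of the others.\<close>
lemma two_chains_occurrences:
  assumes "two_chains n \<pi> b"
  obtains i k where "occurrences_321 n \<pi> = {(i, b, k)}"
proof -
  have perm: "\<pi> permutes {1..n}" and b: "b \<in> {1..n}" "\<pi> b = b"
    and D: "strict_mono_on (deficiencies \<pi>) \<pi>"
    and N: "strict_mono_on ({1..n} - deficiencies \<pi> - {b}) \<pi>"
    and card1: "card {k. b < k \<and> \<pi> k < b} = 1"
    using assms by (auto simp: two_chains_def)
  obtain k where k: "{k. b < k \<and> \<pi> k < b} = {k}"
    using card1 card_1_singletonE by blast
  obtain i where i: "{i. i < b \<and> b < \<pi> i} = {i}"
    using card1 crossings_balanced[OF perm b(2)] card_1_singletonE by metis
  have noD: "\<not> (x \<in> deficiencies \<pi> \<and> y \<in> deficiencies \<pi>)" if "x < y" "\<pi> y < \<pi> x" for x y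
    using strict_mono_onD[OF D] that by (meson not_less_iff_gr_or_eq)
  have noN: "x \<in> deficiencies \<pi> \<or> y \<in> deficiencies \<pi> \<or> x = b \<or> y = b"
    if "x < y" "\<pi> y < \<pi> x" "1 \<le> x" "y \<le> n" for x y
    using strict_mono_onD[OF N, of x y] that by auto
  have "occurrences_321 n \<pi> = {(i, b, k)}"
  proof (intro equalityI subsetI)
    fix t assume "t \<in> occurrences_321 n \<pi>"
    then obtain x y z where t: "t = (x, y, z)" "1 \<le> x" "x < y" "y < z" "z \<le> n" "\<pi> y < \<pi> x" "\<pi> z < \<pi> y"
      by (auto simp: occurrences_321_def)
    have xz: "\<not> (x \<in> deficiencies \<pi> \<and> y \<in> deficiencies \<pi>)" "\<not> (y \<in> deficiencies \<pi> \<and> z \<in> deficiencies \<pi>)"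
      "\<not> (x \<in> deficiencies \<pi> \<and> z \<in> deficiencies \<pi>)"
      using noD[of x y] noD[of y z] noD[of x z] t by auto
    \<comment> \<open>Three mutually inverted entries include at most one from each increasing sequence, so one of
      them is \<open>b\<close>. As first or last entry the fixed point would leave two entries of the same kind.\<close>
    have y: "y = b"
    proof (rule ccontr)
      assume "y \<noteq> b"
      have "x = b \<or> z = b"
        using noN[of x y] noN[of y z] noN[of x z] xz t \<open>y \<noteq> b\<close> by auto
      then show False
      proof
        assume "x = b"
        then have "y \<in> deficiencies \<pi>" "z \<in> deficiencies \<pi>"
          using t b by (auto simp: deficiencies_def)
        then show False using xz by blast
      next
        assume "z = b"
        then have "x \<notin> deficiencies \<pi>" "y \<notin> deficiencies \<pi>" "x \<noteq> b"
          using t b by (auto simp: deficiencies_def)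
        then show False using noN[of x y] t \<open>y \<noteq> b\<close> by auto
      qed
    qed
    then have "x \<in> {i. i < b \<and> b < \<pi> i}" "z \<in> {k. b < k \<and> \<pi> k < b}"
      using t b by auto
    then show "t \<in> {(i, b, k)}"
      using t(1) y i k by simp
  next
    fix t assume t: "t \<in> {(i, b, k)}"
    have ik: "i < b" "b < \<pi> i" "b < k" "\<pi> k < b"
      using i k by auto
    have "k \<le> n"
      using subsetD[OF deficiencies_subset[OF perm], of k] ik by (simp add: deficiencies_def)
    moreover have "1 \<le> i"
      using ik permutes_not_in[OF perm, of 0] by (cases i) auto
    ultimately show "t \<in> occurrences_321 n \<pi>"
      using t ik b by (simp add: occurrences_321_def)
  qed
  then show ?thesis by (rule that)
qed

lemma two_chains_unique:
  assumes "two_chains n \<pi> b" "two_chains n \<pi> c"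
  shows "b = c"
  using two_chains_occurrences[OF assms(1)] two_chains_occurrences[OF assms(2)]
  by (metis Pair_inject singleton_inject)

lemma perms_321_once_iff: "\<pi> \<in> perms_321_once n \<longleftrightarrow> (\<exists>b. two_chains n \<pi> b)"
proof
  assume "\<pi> \<in> perms_321_once n"
  then show "\<exists>b. two_chains n \<pi> b"
    by (auto simp: perms_321_once_def intro: perms_321_once_imp_two_chains)
next
  assume "\<exists>b. two_chains n \<pi> b"
  then obtain b where b: "two_chains n \<pi> b" ..
  obtain i k where "occurrences_321 n \<pi> = {(i, b, k)}"
    using two_chains_occurrences[OF b] .
  with b show "\<pi> \<in> perms_321_once n"
    by (simp add: perms_321_once_def two_chains_def)
qed

section \<open>Codes of permutations with one occurrence of 321\<close>

text \<open>The ballot condition holds since \<open>\<pi>\<close> maps the deficiencies at positions up to \<open>x\<close> injectively to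
values below \<open>x\<close>.\<close>
lemma code_mem_codes:
  assumes "two_chains n \<pi> b"
  shows "code (\<pi>, b) \<in> codes {1..n} {1..n}"
proof -
  have perm: "\<pi> permutes {1..n}" and b: "b \<in> {1..n}" "\<pi> b = b"
    and card1: "card {k. b < k \<and> \<pi> k < b} = 1"
    using assms by (auto simp: two_chains_def)
  let ?D = "deficiencies \<pi>"
  have inj: "inj_on \<pi> X" for X
    using perm by (metis inj_on_subset permutes_inj subset_UNIV)
  have "ballot ?D (\<pi> ` ?D)"
    unfolding ballot_def
  proof
    fix x assume "x \<in> ?D"
    have "card (?D \<inter> {..x}) = card (\<pi> ` (?D \<inter> {..x}))"
      by (rule card_image[OF inj, symmetric])
    also have "\<dots> \<le> card (\<pi> ` ?D \<inter> {..<x})"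
      by (intro card_mono) (auto simp: deficiencies_def)
    finally show "card (?D \<inter> {..x}) \<le> card (\<pi> ` ?D \<inter> {..<x})" .
  qed
  moreover have "marked ?D (\<pi> ` ?D) b"
  proof -
    have "b \<notin> \<pi> ` ?D"
      using permutes_neq[OF perm, of b] b by (auto simp: deficiencies_def) (metis less_irrefl)
    moreover have "b \<notin> ?D"
      using b by (simp add: deficiencies_def)
    ultimately show ?thesis
      using card_small_deficiency_values[OF perm b(2)] card1 by (simp add: marked_def)
  qed
  ultimately show ?thesis
    using deficiencies_subset[OF perm] image_deficiencies_subset[OF perm] b card_image[OF inj, of ?D]
    by (simp add: code_def codes_def)
qed

text \<open>The permutation is increasing both on the deficiencies and on the remaining positions other than
\<open>b\<close>, and the code tells the positions and the values of either kind.\<close>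
lemma code_inj:
  assumes "two_chains n \<pi> b" "two_chains n \<sigma> c" "code (\<pi>, b) = code (\<sigma>, c)"
  shows "\<pi> = \<sigma>" "b = c"
proof -
  let ?D = "deficiencies \<pi>"
  have eq: "deficiencies \<sigma> = ?D" "\<sigma> ` ?D = \<pi> ` ?D" "c = b"
    using assms(3) by (auto simp: code_def)
  then show "b = c" by simp
  have \<pi>: "\<pi> permutes {1..n}" "\<pi> b = b" "strict_mono_on ?D \<pi>" "strict_mono_on ({1..n} - ?D - {b}) \<pi>"
    using assms(1) by (auto simp: two_chains_def)
  have \<sigma>: "\<sigma> permutes {1..n}" "\<sigma> b = b" "strict_mono_on ?D \<sigma>" "strict_mono_on ({1..n} - ?D - {b}) \<sigma>"
    using assms(2) eq by (auto simp: two_chains_def)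
  have rest: "\<tau> ` ({1..n} - ?D - {b}) = {1..n} - \<tau> ` ?D - {b}"
    if "\<tau> permutes {1..n}" "\<tau> b = b" for \<tau>
    using that permutes_image[OF that(1)] permutes_inj[OF that(1)] by (simp add: image_set_diff)
  show "\<pi> = \<sigma>"
  proof
    fix x
    consider "x \<in> ?D" | "x \<in> {1..n} - ?D - {b}" | "x = b" | "x \<notin> {1..n}" by blast
    then show "\<pi> x = \<sigma> x"
    proof cases
      case 1
      then show ?thesis
        using eq(2) by (intro strict_mono_on_unique[OF \<pi>(3) \<sigma>(3) _ 1]) simp
    next
      case 2
      then show ?thesis
        using eq(2) rest[OF \<pi>(1,2)] rest[OF \<sigma>(1,2)]
        by (intro strict_mono_on_unique[OF \<pi>(4) \<sigma>(4) _ 2]) simp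
    next
      case 3
      then show ?thesis using \<pi> \<sigma> by simp
    next
      case 4
      then show ?thesis using permutes_not_in[OF \<pi>(1)] permutes_not_in[OF \<sigma>(1)] by simp
    qed
  qed
qed

text \<open>The permutation maps \<open>A\<close> increasingly to \<open>V\<close>, fixes \<open>b\<close>, and maps the rest increasingly. The ballot
condition makes all entries of the first kind deficiencies. It also says that at least as many values
below \<open>p\<close> lie in \<open>V\<close> as positions up to \<open>p\<close> lie in \<open>A\<close>, and by counting complements no entry of the last
kind is a deficiency.\<close>
lemma code_surj:
  assumes "(A, V, b) \<in> codes {1..n} {1..n}"
  obtains \<pi> where "two_chains n \<pi> b" "code (\<pi>, b) = (A, V, b)"
proof -
  have sub: "A \<subseteq> {1..n}" "V \<subseteq> {1..n}" "b \<in> {1..n}" and bal: "ballot A V" and card: "card V = card A"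
    and b: "b \<notin> A" "b \<notin> V" "card (V \<inter> {..<b}) = Suc (card (A \<inter> {..<b}))"
    using assms by (auto simp: codes_def marked_def)
  have finite: "finite A" "finite V"
    using sub finite_subset by (meson finite_atLeastAtMost)+
  define N where "N = {1..n} - A - {b}"
  define W where "W = {1..n} - V - {b}"
  have cardNW: "card N = card W"
    using sub b card finite by (simp add: N_def W_def card_Diff_subset card_Diff_singleton)
  obtain f where f: "bij_betw f A V" "strict_mono_on A f"
    using ex_order_iso[OF finite] card by metis
  obtain g where g: "bij_betw g N W" "strict_mono_on N g"
    using ex_order_iso[of N W] cardNW by (auto simp: N_def W_def)
  have fA: "f ` A = V" and gN: "g ` N = W"
    using f g by (auto simp: bij_betw_def)
  have f_less: "f p < p" if "p \<in> A" for p
  proof (rule ccontr)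
    assume "\<not> f p < p"
    moreover have "f p \<in> V" using that fA by blast
    ultimately have "V \<inter> {..<p} \<subset> V \<inter> {..f p}" by auto
    then have "card (V \<inter> {..<p}) < card (f ` A \<inter> {..f p})"
      unfolding fA by (intro psubset_card_mono) auto
    also have "\<dots> = card (A \<inter> {..p})"
      using f(2) that by (rule strict_mono_on_rank)
    finally show False
      using bal that by (auto simp: ballot_def not_le)
  qed
  have g_ge: "p \<le> g p" if "p \<in> N" for p
  proof (rule ccontr)
    \<comment> \<open>If \<open>g p < p\<close>, there are too few values below \<open>p\<close>: those in \<open>W\<close> would be at least as many as the
      positions up to \<open>p\<close> in \<open>N\<close>, and those in \<open>V\<close> at least as many as the positions up to \<open>p\<close> in \<open>A\<close>.\<close>
    assume "\<not> p \<le> g p"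
    have "p \<noteq> b" "1 \<le> p" "p \<le> n"
      using that by (auto simp: N_def)
    have "card (N \<inter> {..p}) = card (g ` N \<inter> {..g p})"
      using strict_mono_on_rank[OF g(2) that] by simp
    also have "\<dots> \<le> card (W \<inter> {..<p})"
      unfolding gN using \<open>\<not> p \<le> g p\<close> by (intro card_mono) auto
    finally have le1: "card (N \<inter> {..p}) \<le> card (W \<inter> {..<p})" .
    have "card (A \<inter> {..p}) = card (f ` (A \<inter> {..p}))"
      using f(1) by (intro card_image[symmetric]) (auto simp: bij_betw_def intro: inj_on_subset)
    also have "\<dots> \<le> card (V \<inter> {..<p})"
      using f_less fA by (intro card_mono) fastforce+
    finally have le2: "card (A \<inter> {..p}) \<le> card (V \<inter> {..<p})" .
    have "{1..p} = (A \<inter> {..p}) \<union> (N \<inter> {..p}) \<union> ({b} \<inter> {..<p})"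
      using sub \<open>p \<noteq> b\<close> \<open>p \<le> n\<close> by (auto simp: N_def)
    then have "card {1..p} = card ((A \<inter> {..p}) \<union> (N \<inter> {..p}) \<union> ({b} \<inter> {..<p}))"
      by (rule arg_cong)
    also have "\<dots> = card (A \<inter> {..p}) + card (N \<inter> {..p}) + card ({b} \<inter> {..<p})"
      using b by (subst card_Un_disjoint; (subst card_Un_disjoint)?) (auto simp: N_def)
    finally have eq1: "p = card (A \<inter> {..p}) + card (N \<inter> {..p}) + card ({b} \<inter> {..<p})"
      by simp
    have "{1..<p} = (V \<inter> {..<p}) \<union> (W \<inter> {..<p}) \<union> ({b} \<inter> {..<p})"
      using sub \<open>p \<le> n\<close> by (auto simp: W_def)
    then have "card {1..<p} = card ((V \<inter> {..<p}) \<union> (W \<inter> {..<p}) \<union> ({b} \<inter> {..<p}))"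
      by (rule arg_cong)
    also have "\<dots> = card (V \<inter> {..<p}) + card (W \<inter> {..<p}) + card ({b} \<inter> {..<p})"
      using b by (subst card_Un_disjoint; (subst card_Un_disjoint)?) (auto simp: W_def)
    finally show False
      using eq1 le1 le2 \<open>1 \<le> p\<close> by simp
  qed
  define \<pi> where "\<pi> = (\<lambda>p. if p \<in> A then f p else if p \<in> N then g p else p)"
  have \<pi>A: "\<pi> p = f p" if "p \<in> A" for p
    using that by (simp add: \<pi>_def)
  have \<pi>N: "\<pi> p = g p" if "p \<in> N" for p
    using that by (auto simp: \<pi>_def N_def)
  have \<pi>b: "\<pi> b = b"
    using b by (auto simp: \<pi>_def N_def)
  have "bij_betw \<pi> (A \<union> N \<union> {b}) (V \<union> W \<union> {b})"
  proof (intro bij_betw_combine)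
    show "bij_betw \<pi> A V"
      using f(1) \<pi>A by (simp cong: bij_betw_cong)
    show "bij_betw \<pi> N W"
      using g(1) \<pi>N by (simp cong: bij_betw_cong)
    show "bij_betw \<pi> {b} {b}"
      by (simp add: \<pi>b bij_betw_def)
  qed (use b in \<open>auto simp: W_def\<close>)
  moreover have "A \<union> N \<union> {b} = {1..n}" "V \<union> W \<union> {b} = {1..n}"
    using sub by (auto simp: N_def W_def)
  ultimately have perm: "\<pi> permutes {1..n}"
    by (intro bij_imp_permutes) (use sub in \<open>auto simp: \<pi>_def N_def\<close>)
  have D: "deficiencies \<pi> = A"
    using f_less g_ge by (force simp: deficiencies_def \<pi>_def N_def)
  have img: "\<pi> ` A = V"
    using fA \<pi>A by auto
  have "strict_mono_on A \<pi>" "strict_mono_on N \<pi>"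
    using f(2) g(2) \<pi>A \<pi>N by (auto simp: strict_mono_on_def)
  moreover have "card {k. b < k \<and> \<pi> k < b} = 1"
    using card_small_deficiency_values[OF perm \<pi>b] b(3) by (simp add: D img)
  ultimately have "two_chains n \<pi> b"
    using perm sub \<pi>b by (simp add: two_chains_def D N_def)
  moreover have "code (\<pi>, b) = (A, V, b)"
    by (simp add: code_def D img)
  ultimately show ?thesis by (rule that)
qed

text \<open>The set \<open>S\<close> is \<open>{1..n}\<close> for all permutations, and the set of even numbers for the Dumont permutations
of the fourth kind.\<close>
lemma card_perms_321_once_deficiencies_in:
  assumes "S \<subseteq> {1..n}"
  shows "card {\<pi> \<in> perms_321_once n. deficiencies \<pi> \<subseteq> S \<and> \<pi> ` deficiencies \<pi> \<subseteq> S}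
    = card (codes S {1..n})"
proof -
  define X where "X = {(\<pi>, b). two_chains n \<pi> b \<and> deficiencies \<pi> \<subseteq> S \<and> \<pi> ` deficiencies \<pi> \<subseteq> S}"
  have "fst ` X = {\<pi> \<in> perms_321_once n. deficiencies \<pi> \<subseteq> S \<and> \<pi> ` deficiencies \<pi> \<subseteq> S}"
    by (auto simp: X_def perms_321_once_iff image_iff image_subset_iff)
  moreover have "inj_on fst X"
    by (auto simp: X_def inj_on_def intro: two_chains_unique)
  moreover have "code ` X = codes S {1..n}"
  proof (intro equalityI subsetI)
    fix t assume "t \<in> code ` X"
    then obtain \<pi> b where \<pi>: "(\<pi>, b) \<in> X" "t = code (\<pi>, b)"
      by auto
    then have "t \<in> codes {1..n} {1..n}"
      using code_mem_codes[of n \<pi> b] by (simp add: X_def)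
    with \<pi> show "t \<in> codes S {1..n}"
      by (simp add: X_def code_def codes_def)
  next
    fix t assume t: "t \<in> codes S {1..n}"
    then obtain A V b where AV: "t = (A, V, b)" "A \<subseteq> S" "V \<subseteq> S"
      by (auto simp: codes_def)
    moreover from this t assms have "(A, V, b) \<in> codes {1..n} {1..n}"
      by (auto simp: codes_def)
    then obtain \<pi> where \<pi>: "two_chains n \<pi> b" "code (\<pi>, b) = (A, V, b)"
      using code_surj by metis
    moreover from this AV have "(\<pi>, b) \<in> X"
      by (auto simp: X_def code_def)
    ultimately show "t \<in> code ` X"
      by (metis image_eqI)
  qed
  moreover have "inj_on code X"
  proof (rule inj_onI)
    fix x y assume "x \<in> X" "y \<in> X" "code x = code y"
    then show "x = y"
      using code_inj[of n "fst x" "snd x" "fst y" "snd y"]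
      by (auto simp: X_def prod_eq_iff split: prod.splits)
  qed
  ultimately show ?thesis
    by (metis card_image)
qed

lemma card_perms_321_once: "card (perms_321_once n) = card (codes {1..n} {1..n})"
proof -
  have "deficiencies \<pi> \<subseteq> {1..n} \<and> \<pi> ` deficiencies \<pi> \<subseteq> {1..n}" if "\<pi> \<in> perms_321_once n" for \<pi>
    using that deficiencies_subset image_deficiencies_subset by (simp add: perms_321_once_def)
  then have "perms_321_once n =
      {\<pi> \<in> perms_321_once n. deficiencies \<pi> \<subseteq> {1..n} \<and> \<pi> ` deficiencies \<pi> \<subseteq> {1..n}}"
    by blast
  then show ?thesis
    using card_perms_321_once_deficiencies_in[of "{1..n}" n] by simp
qed

lemma card_dumont4_321_once:
  "card (dumont4_321_once (2 * n)) = card (codes ((*) 2 ` {1..n}) {1..2 * n})"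
proof -
  have evens: "(*) 2 ` {1..n} = {x \<in> {1..2 * n}. even x}"
    by (auto elim!: evenE)
  have "dumont4_321_once (2 * n) = {\<pi> \<in> perms_321_once (2 * n).
      deficiencies \<pi> \<subseteq> (*) 2 ` {1..n} \<and> \<pi> ` deficiencies \<pi> \<subseteq> (*) 2 ` {1..n}}"
    (is "_ = ?R")
  proof (intro set_eqI)
    fix \<pi>
    show "\<pi> \<in> dumont4_321_once (2 * n) \<longleftrightarrow> \<pi> \<in> ?R"
    proof (cases "\<pi> permutes {1..2 * n}")
      case True
      have "deficiencies \<pi> \<subseteq> {1..2 * n}" "\<pi> ` deficiencies \<pi> \<subseteq> {1..2 * n}"
        using deficiencies_subset[OF True] image_deficiencies_subset[OF True] .
      then have "(deficiencies \<pi> \<subseteq> (*) 2 ` {1..n} \<and> \<pi> ` deficiencies \<pi> \<subseteq> (*) 2 ` {1..n}) \<longleftrightarrow>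
          (\<forall>i\<in>{1..2 * n}. \<pi> i < i \<longrightarrow> even i \<and> even (\<pi> i))"
        unfolding evens by (fastforce simp: deficiencies_def)
      then show ?thesis
        by (auto simp: dumont4_321_once_def dumont4_def perms_321_once_def)
    qed (simp add: dumont4_321_once_def dumont4_def perms_321_once_def)
  qed
  moreover have "(*) 2 ` {1..n} \<subseteq> {1..2 * n}"
    by auto
  ultimately show ?thesis
    using card_perms_321_once_deficiencies_in by simp
qed

section \<open>Codes of Dumont permutations\<close>

definition codes_at :: "nat set \<Rightarrow> nat \<Rightarrow> (nat set \<times> nat set) set" where
  "codes_at S b = {(A, V). A \<subseteq> S \<and> V \<subseteq> S \<and> ballot A V \<and> card V = card A \<and> marked A V b}"

lemma card_codes:
  assumes "finite S" "finite B"
  shows "card (codes S B) = (\<Sum>b\<in>B. card (codes_at S b))"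
proof -
  have "bij_betw (\<lambda>(b, A, V). (A, V, b)) (SIGMA b:B. codes_at S b) (codes S B)"
    by (rule bij_betw_byWitness[where f' = "\<lambda>(A, V, b). (b, A, V)"])
       (auto simp: codes_def codes_at_def)
  then have "card (codes S B) = card (SIGMA b:B. codes_at S b)"
    by (metis bij_betw_same_card)
  moreover have "finite (codes_at S b)" for b
    by (rule finite_subset[of _ "Pow S \<times> Pow S"]) (use assms in \<open>auto simp: codes_at_def\<close>)
  ultimately show ?thesis
    using assms by (simp add: card_SigmaI)
qed

lemma codes_at_remove: "codes_at (S - {b}) b = codes_at S b"
  by (auto simp: codes_at_def marked_def)

text \<open>Ballot condition and height refer only to the relative order of the elements.\<close>
lemma card_codes_at_image:
  fixes h :: "nat \<Rightarrow> nat"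
  assumes "strict_mono h"
  shows "card (codes_at (h ` S) (h b)) = card (codes_at S b)"
proof -
  have inj: "inj h"
    using assms by (rule strict_mono_imp_inj_on)
  have inj': "inj_on h X" for X
    using inj by (rule inj_on_subset) simp
  have up: "h ` X \<inter> {..h x} = h ` (X \<inter> {..x})" "h ` X \<inter> {..<h x} = h ` (X \<inter> {..<x})" for X x
    using assms by (auto simp: strict_mono_less strict_mono_less_eq)
  have ballot: "ballot (h ` A) (h ` V) \<longleftrightarrow> ballot A V" for A V
    by (simp add: ballot_def up card_image[OF inj'])
  have marked: "marked (h ` A) (h ` V) (h b) \<longleftrightarrow> marked A V b" for A V
    by (simp add: marked_def up card_image[OF inj'] inj_image_mem_iff[OF inj])
  have "bij_betw (map_prod ((`) h) ((`) h)) (codes_at S b) (codes_at (h ` S) (h b))"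
    unfolding bij_betw_def
  proof
    show "inj_on (map_prod ((`) h) ((`) h)) (codes_at S b)"
      by (auto simp: inj_on_def inj_image_eq_iff[OF inj])
    show "map_prod ((`) h) ((`) h) ` codes_at S b = codes_at (h ` S) (h b)"
    proof (intro equalityI subsetI)
      fix t assume "t \<in> map_prod ((`) h) ((`) h) ` codes_at S b"
      then show "t \<in> codes_at (h ` S) (h b)"
        by (auto simp: codes_at_def ballot marked card_image[OF inj'])
    next
      fix t assume t: "t \<in> codes_at (h ` S) (h b)"
      then obtain A V where "t = (h ` A, h ` V)" "A \<subseteq> S" "V \<subseteq> S"
        by (auto simp: codes_at_def subset_image_iff)
      with t show "t \<in> map_prod ((`) h) ((`) h) ` codes_at S b"
        by (intro image_eqI[of _ _ "(A, V)"]) (auto simp: codes_at_def ballot marked card_image[OF inj'])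
    qed
  qed
  then show ?thesis
    by (metis bij_betw_same_card)
qed

text \<open>A path with a mark at height 1 has to come down to height 0 afterwards, so the mark is not its last
step.\<close>
lemma codes_at_last_empty: "codes_at {1..Suc n} (Suc n) = {}"
proof -
  have False if "(A, V) \<in> codes_at {1..Suc n} (Suc n)" for A V
  proof -
    have "A \<inter> {..<Suc n} = A" "V \<inter> {..<Suc n} = V"
      using that by (auto simp: codes_at_def marked_def subset_eq Ball_def le_less)
    with that show False
      by (auto simp: codes_at_def marked_def)
  qed
  then show ?thesis by auto
qed

text \<open>Even marks \<open>2 * c\<close> correspond to marks \<open>c\<close> on paths of length \<open>n\<close>. An odd mark \<open>2 * c - 1\<close> falls between
two steps of the halved path, and the mark becomes an additional step \<open>c\<close> there. The mark \<open>c = n + 1\<close>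
has no counterpart, but it is not attained either.\<close>
lemma card_codes_even:
  "card (codes ((*) 2 ` {1..n}) {1..2 * n}) =
    card (codes {1..n} {1..n}) + card (codes {1..n + 1} {1..n + 1})"
proof -
  let ?E = "(*) 2 ` {1..n}"
  have even: "card (codes_at ?E (2 * c)) = card (codes_at {1..n} c)" for c
    by (rule card_codes_at_image) (simp add: strict_mono_def)
  have odd: "card (codes_at ?E (2 * c - 1)) = card (codes_at {1..n + 1} c)" if "c \<in> {1..n + 1}" for c
  proof -
    \<comment> \<open>The increasing map with value \<open>2 * c - 1\<close> at \<open>c\<close> that enumerates the even numbers on the
      other arguments; it undoes the insertion of the marked step \<open>c\<close>.\<close>
    define h where "h x = (if x < c then 2 * x else if x = c then 2 * c - 1 else 2 * x - 2)" for x
    have "strict_mono h"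
      unfolding strict_mono_def h_def using that by auto
    moreover have "h ` ({1..n + 1} - {c}) = ?E"
    proof (intro equalityI subsetI)
      fix y assume "y \<in> h ` ({1..n + 1} - {c})"
      then obtain x where x: "x \<in> {1..n + 1}" "x \<noteq> c" "y = h x" by blast
      show "y \<in> ?E"
        using x that by (intro image_eqI[of _ _ "if x < c then x else x - 1"]) (auto simp: h_def)
    next
      fix y assume "y \<in> ?E"
      then obtain z where z: "z \<in> {1..n}" "y = 2 * z" by auto
      show "y \<in> h ` ({1..n + 1} - {c})"
        using z by (intro image_eqI[of _ _ "if z < c then z else z + 1"]) (auto simp: h_def)
    qed
    moreover have "h c = 2 * c - 1"
      by (simp add: h_def)
    ultimately have "card (codes_at ?E (2 * c - 1)) = card (codes_at ({1..n + 1} - {c}) c)"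
      by (metis card_codes_at_image)
    then show ?thesis
      by (simp only: codes_at_remove)
  qed
  have "(\<Sum>b\<in>{1..2 * n}. f b) = (\<Sum>c\<in>{1..n}. f (2 * c)) + (\<Sum>c\<in>{1..n}. f (2 * c - 1))" for f :: "nat \<Rightarrow> nat"
    by (induction n) auto
  then have "card (codes ?E {1..2 * n}) =
      (\<Sum>c\<in>{1..n}. card (codes_at {1..n} c)) + (\<Sum>c\<in>{1..n}. card (codes_at {1..n + 1} c))"
    by (simp add: card_codes even[simplified] odd[simplified])
  also have "(\<Sum>c\<in>{1..n}. card (codes_at {1..n + 1} c)) = (\<Sum>c\<in>{1..n + 1}. card (codes_at {1..n + 1} c))"
    by (simp add: codes_at_last_empty[simplified])
  finally show ?thesis
    by (simp add: card_codes)
qed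

section \<open>Recurrences for ballot pairs\<close>

text \<open>Pairs of subsets of \<open>{1..n}\<close> whose path ends at height \<open>d\<close>. The predicate \<open>E\<close> is either trivial or
prescribes a mark, so that both kinds of paths obey the same recurrence.\<close>
definition ballot_count :: "(nat set \<Rightarrow> nat set \<Rightarrow> bool) \<Rightarrow> nat \<Rightarrow> nat \<Rightarrow> nat" where
  "ballot_count E n d =
     card {(A, V). A \<subseteq> {1..n} \<and> V \<subseteq> {1..n} \<and> ballot A V \<and> card V = card A + d \<and> E A V}"

lemma card_pairs_insert:
  fixes S :: "'a set"
  assumes "finite S" "N \<notin> S"
  shows "card {(A, V). A \<subseteq> insert N S \<and> V \<subseteq> insert N S \<and> R A V} =
      card {(A, V). A \<subseteq> S \<and> V \<subseteq> S \<and> R A V}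
    + card {(A, V). A \<subseteq> S \<and> V \<subseteq> S \<and> R A (insert N V)}
    + card {(A, V). A \<subseteq> S \<and> V \<subseteq> S \<and> R (insert N A) V}
    + card {(A, V). A \<subseteq> S \<and> V \<subseteq> S \<and> R (insert N A) (insert N V)}"
proof -
  have sum_Pow: "(\<Sum>A\<in>Pow (insert N S). f A) = (\<Sum>A\<in>Pow S. f A + f (insert N A))"
    for f :: "'a set \<Rightarrow> nat"
  proof -
    have "inj_on (insert N) (Pow S)"
      using assms(2) by (auto simp: inj_on_def)
    moreover have "Pow S \<inter> insert N ` Pow S = {}"
      using assms(2) by auto
    ultimately show ?thesis
      using assms(1) by (simp add: Pow_insert sum.union_disjoint sum.reindex sum.distrib)
  qed
  have card_eq: "card {(A, V). A \<subseteq> U \<and> V \<subseteq> U \<and> Q A V} =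
      (\<Sum>A\<in>Pow U. \<Sum>V\<in>Pow U. of_bool (Q A V))" if "finite U" for U and Q :: "'a set \<Rightarrow> 'a set \<Rightarrow> bool"
  proof -
    have "{(A, V). A \<subseteq> U \<and> V \<subseteq> U \<and> Q A V} = (SIGMA A:Pow U. {V\<in>Pow U. Q A V})"
      by auto
    moreover have "card {V\<in>Pow U. Q A V} = (\<Sum>V\<in>Pow U. of_bool (Q A V))" for A
      using that by (simp add: of_bool_def flip: sum.inter_filter)
    ultimately show ?thesis
      using that by (simp add: card_SigmaI)
  qed
  show ?thesis
    using assms(1) by (simp add: card_eq sum_Pow sum.distrib)
qed

lemma ballot_insert_above:
  assumes "A \<subseteq> {1..n}" "V \<subseteq> {1..n}"
  shows "ballot A (insert (Suc n) V) \<longleftrightarrow> ballot A V"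
    and "ballot (insert (Suc n) A) V \<longleftrightarrow> ballot A V \<and> card A < card V"
    and "ballot (insert (Suc n) A) (insert (Suc n) V) \<longleftrightarrow> ballot A V \<and> card A < card V"
proof -
  have V: "insert (Suc n) V \<inter> {..<x} = V \<inter> {..<x}" if "x \<in> insert (Suc n) A" for x
    using assms that by auto
  have A: "insert (Suc n) A \<inter> {..x} = A \<inter> {..x}" if "x \<in> A" for x
    using assms that by auto
  have last: "insert (Suc n) A \<inter> {..Suc n} = insert (Suc n) A" "V \<inter> {..<Suc n} = V"
    using assms by auto
  have "finite A" "Suc n \<notin> A"
    using assms finite_subset by auto
  then have "card (insert (Suc n) A) = Suc (card A)"
    by simp
  with V A last show "ballot A (insert (Suc n) V) \<longleftrightarrow> ballot A V"
    "ballot (insert (Suc n) A) V \<longleftrightarrow> ballot A V \<and> card A < card V"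
    "ballot (insert (Suc n) A) (insert (Suc n) V) \<longleftrightarrow> ballot A V \<and> card A < card V"
    by (auto simp: ballot_def)
qed

text \<open>Heights stay nonnegative: the last step in \<open>A\<close> starts at positive height, and no later step goes down.\<close>
lemma ballot_card_le:
  assumes "ballot A V" "finite A" "finite V"
  shows "card A \<le> card V"
proof (cases "A = {}")
  case False
  then have "Max A \<in> A" "A \<inter> {..Max A} = A"
    using assms(2) by auto
  then have "card A \<le> card (V \<inter> {..<Max A})"
    using assms(1) by (metis ballot_def)
  also have "\<dots> \<le> card V"
    using assms(3) by (intro card_mono) auto
  finally show ?thesis .
qed simp

text \<open>The last step is an empty level step, a step down (from height \<open>d + 1\<close>), a level step in both sets, or a
step up (from height \<open>d - 1\<close>). The last two need \<open>d > 0\<close>.\<close>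
lemma ballot_count_Suc:
  assumes E: "\<And>A V. A \<subseteq> {1..n} \<Longrightarrow> V \<subseteq> {1..n} \<Longrightarrow>
    E (insert (Suc n) A) V = E A V \<and> E A (insert (Suc n) V) = E A V \<and>
    E (insert (Suc n) A) (insert (Suc n) V) = E A V"
  shows "ballot_count E (Suc n) d = ballot_count E n d + ballot_count E n (Suc d)
     + (case d of 0 \<Rightarrow> 0 | Suc d' \<Rightarrow> ballot_count E n d + ballot_count E n d')"
proof -
  let ?R = "\<lambda>d A V. ballot A V \<and> card V = card A + d \<and> E A V"
  have ins: "card (insert (Suc n) A) = Suc (card A)" if "A \<subseteq> {1..n}" for A
    using that finite_subset[OF that] by (subst card_insert_disjoint) auto
  have nz: "Suc (card V) \<noteq> card A" if "A \<subseteq> {1..n}" "V \<subseteq> {1..n}" "ballot A V" for A V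
    using ballot_card_le[OF that(3)] that(1,2) finite_subset[of _ "{1..n}"] by force
  have V: "{(A, V). A \<subseteq> {1..n} \<and> V \<subseteq> {1..n} \<and> ?R d A (insert (Suc n) V)} =
      (case d of 0 \<Rightarrow> {} | Suc d' \<Rightarrow> {(A, V). A \<subseteq> {1..n} \<and> V \<subseteq> {1..n} \<and> ?R d' A V})"
    by (auto simp: E ins ballot_insert_above nz split: nat.splits)
  have A: "{(A, V). A \<subseteq> {1..n} \<and> V \<subseteq> {1..n} \<and> ?R d (insert (Suc n) A) V} =
      {(A, V). A \<subseteq> {1..n} \<and> V \<subseteq> {1..n} \<and> ?R (Suc d) A V}"
    by (auto simp: E ins ballot_insert_above)
  have AV: "{(A, V). A \<subseteq> {1..n} \<and> V \<subseteq> {1..n} \<and> ?R d (insert (Suc n) A) (insert (Suc n) V)} =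
      (case d of 0 \<Rightarrow> {} | Suc d' \<Rightarrow> {(A, V). A \<subseteq> {1..n} \<and> V \<subseteq> {1..n} \<and> ?R d A V})"
    by (auto simp: E ins ballot_insert_above split: nat.splits)
  have "{1..Suc n} = insert (Suc n) {1..n}"
    by auto
  then show ?thesis
    unfolding ballot_count_def
    by (simp only: card_pairs_insert finite_atLeastAtMost atLeastAtMost_iff Suc_n_not_le_n simp_thms A V AV)
       (simp split: nat.splits)
qed

lemma ballot_count_empty: "ballot_count E 0 d = (if d = 0 \<and> E {} {} then 1 else 0)"
proof -
  have "{(A, V). A \<subseteq> {1..0::nat} \<and> V \<subseteq> {1..0} \<and> ballot A V \<and> card V = card A + d \<and> E A V} =
    (if d = 0 \<and> E {} {} then {({}, {})} else {})"
    by (auto simp: ballot_def)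
  then show ?thesis
    by (simp add: ballot_count_def)
qed

definition unmarked_count :: "nat \<Rightarrow> nat \<Rightarrow> nat" where
  "unmarked_count n d = ballot_count (\<lambda>_ _. True) n d"

definition marked_count :: "nat \<Rightarrow> nat \<Rightarrow> nat" where
  "marked_count n d = (\<Sum>b\<in>{1..n}. ballot_count (\<lambda>A V. marked A V b) n d)"

lemma unmarked_count_Suc:
  "unmarked_count (Suc n) d = unmarked_count n d + unmarked_count n (Suc d)
     + (case d of 0 \<Rightarrow> 0 | Suc d' \<Rightarrow> unmarked_count n d + unmarked_count n d')"
  unfolding unmarked_count_def by (rule ballot_count_Suc) simp

lemma ballot_count_marked_last:
  "ballot_count (\<lambda>A V. marked A V (Suc n)) (Suc n) d = (if d = 1 then unmarked_count n 1 else 0)"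
proof -
  have fin: "A \<inter> {..<Suc n} = A" if "A \<subseteq> {1..n}" for A
    using that by auto
  have sub: "A \<subseteq> {1..n}" if "A \<subseteq> {1..Suc n}" "Suc n \<notin> A" for A
    using that by (force simp: subset_eq le_Suc_eq)
  have "{(A, V). A \<subseteq> {1..Suc n} \<and> V \<subseteq> {1..Suc n} \<and> ballot A V \<and> card V = card A + d
        \<and> marked A V (Suc n)} =
      {(A, V). A \<subseteq> {1..n} \<and> V \<subseteq> {1..n} \<and> ballot A V \<and> card V = card A + d \<and> d = 1}"
    (is "?L = ?R")
  proof (intro set_eqI iffI)
    fix p assume "p \<in> ?L"
    then obtain A V where p: "p = (A, V)" "A \<subseteq> {1..n}" "V \<subseteq> {1..n}" "ballot A V"
        "card V = card A + d" "marked A V (Suc n)"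
      using sub by (fastforce simp: marked_def)
    then show "p \<in> ?R"
      by (auto simp: marked_def fin)
  next
    fix p assume "p \<in> ?R"
    then show "p \<in> ?L"
      by (force simp: marked_def fin)
  qed
  then show ?thesis
    by (simp add: ballot_count_def unmarked_count_def)
qed

text \<open>The extra summand stands for paths whose mark is the last step.\<close>
lemma marked_count_Suc:
  "marked_count (Suc n) d = marked_count n d + marked_count n (Suc d)
     + (case d of 0 \<Rightarrow> 0 | Suc d' \<Rightarrow> marked_count n d + marked_count n d')
     + (if d = 1 then unmarked_count n 1 else 0)"
proof -
  have "ballot_count (\<lambda>A V. marked A V b) (Suc n) d =
      ballot_count (\<lambda>A V. marked A V b) n d + ballot_count (\<lambda>A V. marked A V b) n (Suc d)
     + (case d of 0 \<Rightarrow> 0 | Suc d' \<Rightarrow>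
        ballot_count (\<lambda>A V. marked A V b) n d + ballot_count (\<lambda>A V. marked A V b) n d')"
    if "b \<in> {1..n}" for b
    using that by (intro ballot_count_Suc) (auto simp: marked_def)
  then show ?thesis
    by (simp add: marked_count_def ballot_count_marked_last sum.distrib split: nat.splits)
qed

lemma card_codes_eq: "card (codes {1..n} {1..n}) = marked_count n 0"
  by (simp add: card_codes codes_at_def marked_count_def ballot_count_def)

section \<open>Closed forms\<close>

lemma binom_Suc: "int (binom (Suc a) b) = int (binom a b) + int (binom a (b - 1))"
proof (cases "b \<le> 0")
  case True
  then show ?thesis by (cases "b = 0") (auto simp: binom_def)
next
  case False
  then have "nat b = Suc (nat (b - 1))" by simp
  then show ?thesis using False by (simp add: binom_def)
qed

lemma binom_symmetric: "binom a b = binom a (int a - b)"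
proof -
  consider "b < 0" | "b > int a" | "0 \<le> b" "b \<le> int a" by linarith
  then show ?thesis
  proof cases
    case 3
    then have "nat (int a - b) = a - nat b" "nat b \<le> a" by auto
    with 3 show ?thesis by (simp add: binom_def binomial_symmetric[symmetric])
  qed (auto simp: binom_def)
qed

text \<open>Pascal's rule turns the difference for \<open>n + 1\<close> into the sum of those for \<open>n\<close> with heights \<open>d - 1\<close>, \<open>d\<close>, \<open>d\<close>
and \<open>d + 1\<close>, as the recurrence demands. At \<open>d = 0\<close> the recurrence lacks two of these terms, and by the
symmetry of row \<open>2 * n\<close> they cancel.\<close>
lemma unmarked_count_eq:
  "int (unmarked_count n d) =
     int (binom (2 * n) (int n - int d)) - int (binom (2 * n) (int n - int d - 1))"
proof (induction n arbitrary: d)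
  case 0
  then show ?case
    by (auto simp: unmarked_count_def ballot_count_empty binom_def)
next
  case (Suc n)
  have *: "2 * Suc n = Suc (Suc (2 * n))" by simp
  show ?case
  proof (cases d)
    case 0
    have "binom (2 * n) (1 + int n) = binom (2 * n) (int n - 1)"
      by (subst binom_symmetric) (simp add: algebra_simps)
    with 0 show ?thesis
      unfolding unmarked_count_Suc * binom_Suc
      by (simp add: Suc.IH algebra_simps)
  next
    case (Suc d')
    then show ?thesis
      unfolding unmarked_count_Suc * binom_Suc
      by (simp add: Suc.IH algebra_simps)
  qed
qed

text \<open>With \<open>C\<close> the generating function of the Catalan numbers, \<open>marked_ballot m j\<close> is for \<open>j \<ge> 0\<close> the
coefficient of \<open>z ^ m\<close> in \<open>z ^ (j + 1) * C ^ (2 * j + 4)\<close>. The height \<open>j\<close> is an integer since \<open>j = -1\<close> occurs in the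
recurrence.\<close>
definition marked_ballot :: "nat \<Rightarrow> int \<Rightarrow> int" where
  "marked_ballot m j = int (binom (2 * m + 1) (int m - j - 1)) - int (binom (2 * m + 1) (int m - j - 2))"

lemma marked_ballot_Suc:
  "marked_ballot (Suc m) j = marked_ballot m (j + 1) + 2 * marked_ballot m j + marked_ballot m (j - 1)"
proof -
  have *: "2 * Suc m + 1 = Suc (Suc (2 * m + 1))" by simp
  show ?thesis
    unfolding marked_ballot_def * binom_Suc by (simp add: algebra_simps)
qed

lemma marked_ballot_0: "marked_ballot m 0 + marked_ballot m (-1) = int (unmarked_count (Suc m) 1)"
proof -
  have *: "2 * Suc m = Suc (2 * m + 1)" by simp
  show ?thesis
    unfolding marked_ballot_def unmarked_count_eq * binom_Suc by (simp add: algebra_simps)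
qed

text \<open>First-passage decompositions suggest the formula: the generating function of marked paths that
end at height \<open>d\<close> is \<open>z ^ 3 * C ^ 6\<close> for \<open>d = 0\<close> and \<open>(1 - z) * z ^ (d + 1) * C ^ (2 * d + 4)\<close> otherwise. Once
guessed, it follows by induction from the recurrence, where \<open>marked_ballot_0\<close> accounts for the paths whose
mark is the last step.\<close>
lemma marked_count_eq:
  "int (marked_count (Suc n) d) =
    (if d = 0 then marked_ballot n 1 else marked_ballot (Suc n) (int d) - marked_ballot n (int d))"
proof (induction n arbitrary: d)
  case 0
  have "unmarked_count 0 1 = 0" "marked_count 0 d = 0" for d
    by (simp_all add: unmarked_count_def marked_count_def ballot_count_empty)
  then have "marked_count (Suc 0) d = 0"
    by (simp add: marked_count_Suc split: nat.splits)
  then show ?case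
    by (simp add: marked_ballot_def binom_def)
next
  case (Suc n)
  consider "d = 0" | "d = 1" | d' where "d = Suc (Suc d')"
    by (metis One_nat_def not0_implies_Suc)
  then show ?case
  proof cases
    case 1
    then show ?thesis
      by (simp add: marked_count_Suc[of "Suc n"] Suc.IH)
  next
    case 2
    then show ?thesis
      using marked_ballot_0[of n] marked_ballot_Suc[of n 0]
      by (simp add: marked_count_Suc[of "Suc n"] Suc.IH
          marked_ballot_Suc[of "Suc n" 1] marked_ballot_Suc[of n 1])
  next
    case 3
    have "marked_ballot (Suc n) (int d + 1) + 2 * marked_ballot (Suc n) (int d) + marked_ballot (Suc n) (int d - 1)
        = marked_ballot (Suc (Suc n)) (int d)"
      "marked_ballot n (int d + 1) + 2 * marked_ballot n (int d) + marked_ballot n (int d - 1)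
        = marked_ballot (Suc n) (int d)"
      by (simp_all only: marked_ballot_Suc)
    with 3 show ?thesis
      by (simp add: marked_count_Suc[of "Suc n"] Suc.IH algebra_simps)
  qed
qed

lemma binom_absorption:
  "int k * int (binom (Suc a) (int k)) = int (Suc a) * int (binom a (int k - 1))"
proof (cases "k = 0")
  case False
  then have "int (k * (Suc a choose k)) = int (Suc a * (a choose (k - 1)))"
    using times_binomial_minus1_eq[of k "Suc a"] by simp
  with False show ?thesis
    by (simp add: binom_def nat_diff_distrib algebra_simps)
qed (simp add: binom_def)

text \<open>The number of ballot sequences, as a difference of two binomial coefficients or as a multiple of a
single one.\<close>
lemma ballot_number:
  fixes j :: int
  shows "real (Suc a) * (real (binom a j) - real (binom a (j - 1)))
    = (real (Suc a) - 2 * j) * real (binom (Suc a) j)"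
proof (cases "j < 0")
  case False
  then obtain k where k: "j = int k" using nonneg_int_cases by (metis not_less)
  have "real k * real (binom (Suc a) (int k)) = real (Suc a) * real (binom a (int k - 1))"
    using arg_cong[OF binom_absorption[of k a], of real_of_int] by simp
  moreover have "real (binom (Suc a) (int k)) = real (binom a (int k)) + real (binom a (int k - 1))"
    using arg_cong[OF binom_Suc[of a "int k"], of real_of_int] by simp
  ultimately show ?thesis
    unfolding k by (simp add: algebra_simps)
qed (simp add: binom_def)

lemma marked_ballot_1_eq:
  assumes "n \<ge> 1"
  shows "3 / real n * real (binom (2 * n) (int n - 3)) = of_int (marked_ballot (n - 1) 1)"
proof -
  obtain m where m: "n = Suc m" using assms by (cases n) auto
  have "real (2 * n) * of_int (marked_ballot m 1) = 6 * real (binom (2 * n) (int n - 3))"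
    using ballot_number[of "2 * m + 1" "int m - 2"] by (simp add: m marked_ballot_def algebra_simps)
  then show ?thesis
    using assms by (simp add: m field_simps)
qed

lemma Noonan_formula:
  assumes "n \<ge> 1"
  shows "real (card (perms_321_once n)) = 3 / real n * real (binom (2 * n) (int n - 3))"
proof -
  have "int (marked_count n 0) = marked_ballot (n - 1) 1"
    using marked_count_eq[of "n - 1" 0] assms by simp
  then have "real (marked_count n 0) = of_int (marked_ballot (n - 1) 1)"
    by (metis of_int_of_nat_eq)
  with marked_ballot_1_eq[OF assms] show ?thesis
    by (simp only: card_perms_321_once card_codes_eq)
qed

lemma catalan_eq: "catalan n = real (unmarked_count n 0)"
proof -
  have absorb: "real (binom (2 * n) (int n)) * real n = real (binom (2 * n) (int n - 1)) * real (n + 1)"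
  proof (cases n)
    case (Suc m)
    then have "n * (2 * n choose n) = (2 * n - m) * (2 * n choose m)"
      using binomial_absorption[of m "2 * n"] binomial_absorb_comp[of "2 * n" m] by simp
    moreover have "2 * n - m = n + 1" "nat (int n) = n" "nat (int n - 1) = m" "\<not> int n - 1 < 0"
      using Suc by auto
    ultimately have "binom (2 * n) (int n) * n = binom (2 * n) (int n - 1) * (n + 1)"
      by (simp only: binom_def if_False of_nat_less_0_iff mult.commute)
    then show ?thesis
      by (metis of_nat_mult)
  qed (simp add: binom_def)
  have "real (unmarked_count n 0) = real (binom (2 * n) (int n)) - real (binom (2 * n) (int n - 1))"
    using arg_cong[OF unmarked_count_eq[of n 0], of real_of_int] by simp
  then have "real (n + 1) * real (unmarked_count n 0) = real (binom (2 * n) (int n))"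
    using absorb by (simp only: right_diff_distrib) (simp add: algebra_simps)
  moreover have "catalan n = real (binom (2 * n) (int n)) / real (n + 1)"
    by (simp add: catalan_def binom_def)
  ultimately show ?thesis
    by (metis nonzero_mult_div_cancel_left of_nat_0_eq_iff Suc_eq_plus1 nat.distinct(1))
qed

lemma catalan_combination:
  assumes "n \<ge> 1"
  shows "marked_ballot (n - 1) 1 + marked_ballot n 1 =
      int (unmarked_count (n + 3) 0) - 3 * int (unmarked_count (n + 2) 0)
      - int (unmarked_count (n + 1) 0) + 3 * int (unmarked_count n 0)"
proof -
  \<comment> \<open>The recurrence expresses the right-hand side by the numbers of paths of length \<open>n\<close>, and Pascal's
      rule then expresses both sides by row \<open>2 * n - 1\<close>.\<close>
  define p where "p d = int (unmarked_count n d)" for d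
  have rec: "int (unmarked_count (Suc m) 0) = int (unmarked_count m 0) + int (unmarked_count m 1)"
    "int (unmarked_count (Suc m) (Suc d)) = int (unmarked_count m d) + 2 * int (unmarked_count m (Suc d))
      + int (unmarked_count m (Suc (Suc d)))" for m d
    by (simp_all add: unmarked_count_Suc)
  have Suc: "n + 3 = Suc (Suc (Suc n))" "n + 2 = Suc (Suc n)" "n + 1 = Suc n"
    by simp_all
  have "int (unmarked_count (n + 3) 0) - 3 * int (unmarked_count (n + 2) 0)
      - int (unmarked_count (n + 1) 0) + 3 * int (unmarked_count n 0) = p 0 - p 1 + 2 * p 2 + p 3"
    unfolding Suc by (simp add: rec p_def numeral_2_eq_2 numeral_3_eq_3)
  also have "\<dots> = marked_ballot (n - 1) 1 + marked_ballot n 1"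
  proof -
    obtain m where m: "n = Suc m"
      using assms by (cases n) auto
    have sym: "binom (2 * m + 1) (1 + int m) = binom (2 * m + 1) (int m)"
      using binom_symmetric[of "2 * m + 1" "1 + int m"] by simp
    have *: "2 * Suc m = Suc (2 * m + 1)" "Suc (2 * m + 1) + 1 = Suc (Suc (2 * m + 1))" by simp_all
    show ?thesis
      unfolding p_def marked_ballot_def unmarked_count_eq m * binom_Suc
      using sym by (simp add: algebra_simps)
  qed
  finally show ?thesis by simp
qed

theorem theorem4p10:
  fixes n :: nat
  assumes "n \<ge> 1"
  shows "card (dumont4_321_once (2 * n)) = card (perms_321_once n) + card (perms_321_once (n + 1))
    \<and> real (card (perms_321_once n) + card (perms_321_once (n + 1)))
        = 3 / real n * real (binom (2 * n) (int n - 3))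
          + 3 / real (n + 1) * real (binom (2 * n + 2) (int n - 2))
    \<and> 3 / real n * real (binom (2 * n) (int n - 3))
          + 3 / real (n + 1) * real (binom (2 * n + 2) (int n - 2))
        = catalan (n + 3) - 3 * catalan (n + 2) - catalan (n + 1) + 3 * catalan n"
proof (intro conjI)
  show "card (dumont4_321_once (2 * n)) = card (perms_321_once n) + card (perms_321_once (n + 1))"
    by (simp only: card_dumont4_321_once card_codes_even card_perms_321_once)
  have n1: "3 / real (n + 1) * real (binom (2 * n + 2) (int n - 2)) = of_int (marked_ballot n 1)"
    using marked_ballot_1_eq[of "n + 1"] by simp
  show "real (card (perms_321_once n) + card (perms_321_once (n + 1)))
        = 3 / real n * real (binom (2 * n) (int n - 3))
          + 3 / real (n + 1) * real (binom (2 * n + 2) (int n - 2))"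
    using Noonan_formula[OF assms] Noonan_formula[of "n + 1"] by simp
  show "3 / real n * real (binom (2 * n) (int n - 3))
          + 3 / real (n + 1) * real (binom (2 * n + 2) (int n - 2))
        = catalan (n + 3) - 3 * catalan (n + 2) - catalan (n + 1) + 3 * catalan n"
    unfolding marked_ballot_1_eq[OF assms] n1 catalan_eq
    using arg_cong[OF catalan_combination[OF assms], of real_of_int] by simp
qed

end
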